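(* Let $L_1,\ldots,L_r$, $\Lambda$ and $\mathcal F(\boldsymbol\alpha;P)$ be as follows: $L_i(\mathbf x)=\sum_{j\le n}\lambda_{i,j}x_j$ are real linear forms such that for every $\boldsymbol\alpha\in\mathbb{R}^r\setminus\{\mathbf0\}$ the form $\boldsymbol\alpha\cdot\mathbf L$ does not have all coefficients rational; $\Lambda$ is the $n\times r$ matrix with $(j,i)$ entry $\lambda_{i,j}$; and $\mathcal F(\boldsymbol\alpha;P)=\sup_{q\in\mathbb N,\mathbf a\in\mathbb Z^n}\prod_{v\le n}(q+P|q\lambda_v-a_v|)^{-1}$ with $\boldsymbol\lambda=\Lambda\boldsymbol\alpha$. Let $\theta$ be a small positive real number. Then there exists a function $T:[1,\infty)\to[1,\infty)$, increasing monotonically to infinity, such that $T(P)\le P^\theta$ for all $P$ and \[ \sup_{P^{\theta-1}\le|\Lambda\boldsymbol\alpha|\le T(P)}\mathcal F(\boldsymbol\alpha;P)\le T(P)^{-1}. \]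
   Context: $|\mathbf y|=\max_i|y_i|$ for vectors. *)

theory Defs
  imports "HOL-Analysis.Analysis"
begin

text \<open>Sup norm of a vector: max of absolute values of components.\<close>
definition supnorm :: "real ^ 'n \<Rightarrow> real" where
  "supnorm y = Max (range (\<lambda>v. \<bar>y $ v\<bar>))"

text \<open>Lam is the n x r matrix with (j,i) entry lambda_{i,j}; Lam *v alpha is the
  vector lambda = Lambda alpha.  F(alpha;P) = sup over q in N (q >= 1) and a in Z^n of
  prod_v (q + P |q lambda_v - a_v|)^(-1).\<close>
definition FF :: "real ^ 'r ^ 'n \<Rightarrow> real ^ 'r \<Rightarrow> real \<Rightarrow> real" where
  "FF Lam \<alpha> P = Sup {(\<Prod>v\<in>UNIV. inverse (real q + P * \<bar>real q * (Lam *v \<alpha>) $ v - of_int (a $ v)\<bar>))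
                       | (q::nat) (a::int ^ 'n). q \<ge> 1}"

end

theory Submission
  imports Defs
begin

text \<open>The vectors \<open>y = \<Lambda>\<alpha>\<close> form a closed subspace without nonzero rational points.
  Fix \<open>\<epsilon> > 0\<close> and \<open>B\<close>.  For large \<open>P\<close> every term of \<open>\<F>\<close> is at most \<open>\<epsilon>\<close>, uniformly in \<open>y\<close>
  with \<open>P powr (\<theta> - 1) \<le> |y| \<le> B\<close>: for large \<open>q\<close> the factor \<open>1/q\<close> suffices; for small \<open>q\<close> and
  tiny \<open>|y|\<close> the largest coordinate of \<open>q y\<close> lies at distance at least \<open>|y|\<close> from \<open>\<int>\<close>, so
  \<open>P\<close> times it is at least \<open>P powr \<theta>\<close>; for small \<open>q\<close> and \<open>|y|\<close> bounded below, compactness and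
  irrationality keep some coordinate of \<open>q y\<close> uniformly away from \<open>\<int>\<close>.  With
  \<open>(\<epsilon>, B) = (1/k, k)\<close>, \<open>T P\<close> is the largest \<open>k\<close> whose threshold, also taken above
  \<open>k powr (1/\<theta>)\<close>, is at most \<open>P\<close>.\<close>

lemma supnorm_ge: "\<bar>y $ v\<bar> \<le> supnorm y"
  unfolding supnorm_def by (rule Max_ge) auto

lemma supnorm_attained: "\<exists>v. supnorm y = \<bar>y $ v\<bar>"
proof -
  have "supnorm y \<in> range (\<lambda>v. \<bar>y $ v\<bar>)"
    unfolding supnorm_def by (rule Max_in) auto
  then show ?thesis by auto
qed

lemma supnorm_le_iff: "supnorm y \<le> B \<longleftrightarrow> (\<forall>v. \<bar>y $ v\<bar> \<le> B)"
  by (metis supnorm_attained supnorm_ge order_trans)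

lemma supnorm_ge_iff: "B \<le> supnorm y \<longleftrightarrow> (\<exists>v. B \<le> \<bar>y $ v\<bar>)"
  by (metis supnorm_attained supnorm_ge order_trans)

lemma norm_le_card_mult_supnorm: "norm (y::real^'n) \<le> real CARD('n) * supnorm y"
proof -
  have "norm y \<le> (\<Sum>i\<in>UNIV. \<bar>y$i\<bar>)" by (rule norm_le_l1_cart)
  also have "\<dots> \<le> (\<Sum>i\<in>(UNIV::'n set). supnorm y)" by (rule sum_mono) (rule supnorm_ge)
  finally show ?thesis by simp
qed

lemma closed_supnorm_le: "closed {y::real^'n. supnorm y \<le> B}"
  unfolding supnorm_le_iff
  by (intro closed_Collect_all closed_Collect_le continuous_intros)

lemma closed_supnorm_ge: "closed {y::real^'n. B \<le> supnorm y}"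
proof -
  have "{y::real^'n. B \<le> supnorm y} = (\<Union>v. {y. B \<le> \<bar>y$v\<bar>})"
    by (auto simp: supnorm_ge_iff)
  moreover have "closed (\<Union>v. {y::real^'n. B \<le> \<bar>y$v\<bar>})"
    by (rule closed_UN) (auto intro!: closed_Collect_le continuous_intros)
  ultimately show ?thesis by simp
qed

lemma compact_Int_supnorm_le:
  assumes "closed (S :: (real^'n) set)"
  shows "compact (S \<inter> {y. supnorm y \<le> B})"
proof -
  have "S \<inter> {y. supnorm y \<le> B} \<subseteq> cball 0 (real CARD('n) * B)"
    using norm_le_card_mult_supnorm mult_left_mono[of _ B "real CARD('n)"]
    by (fastforce intro: order_trans)
  then have "bounded (S \<inter> {y. supnorm y \<le> B})"
    using bounded_cball bounded_subset by blast
  moreover have "closed (S \<inter> {y. supnorm y \<le> B})"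
    using assms closed_supnorm_le by (rule closed_Int)
  ultimately show ?thesis by (simp add: compact_eq_bounded_closed)
qed

definition FF_term :: "real \<Rightarrow> real ^ 'n \<Rightarrow> nat \<Rightarrow> int ^ 'n \<Rightarrow> real" where
  "FF_term P y q a = (\<Prod>v\<in>UNIV. inverse (real q + P * \<bar>real q * y $ v - of_int (a $ v)\<bar>))"

lemma FF_term_le_if_factor_large:
  assumes "0 \<le> P" "1 \<le> q" "0 < \<epsilon>"
    and large: "1 / \<epsilon> \<le> real q + P * \<bar>real q * y $ w - of_int (a $ w)\<bar>"
  shows "FF_term P y q a \<le> \<epsilon>"
proof -
  define f where "f v = inverse (real q + P * \<bar>real q * y $ v - of_int (a $ v)\<bar>)" for v
  have f_bounds: "0 \<le> f v \<and> f v \<le> 1" for v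
  proof -
    have "1 \<le> real q + P * \<bar>real q * y $ v - of_int (a $ v)\<bar>"
      using assms(1,2) by (simp add: add_increasing2)
    then show ?thesis unfolding f_def using le_imp_inverse_le[of 1] by fastforce
  qed
  have "FF_term P y q a = f w * prod f (UNIV - {w})"
    by (simp add: FF_term_def f_def prod.remove)
  also have "\<dots> \<le> f w"
    using f_bounds prod_le_1[of "UNIV - {w}" f] by (simp add: mult_left_le)
  also have "f w \<le> inverse (1 / \<epsilon>)"
    unfolding f_def using large \<open>0 < \<epsilon>\<close> by (intro le_imp_inverse_le) auto
  finally show ?thesis by simp
qed

lemma FF_eq_Sup_FF_term: "FF Lam \<alpha> P = Sup {FF_term P (Lam *v \<alpha>) q a | q a. 1 \<le> q}"
  by (simp add: FF_def FF_term_def)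

lemma FF_le:
  assumes "\<And>(q::nat) a. 1 \<le> q \<Longrightarrow> FF_term P (Lam *v \<alpha>) q a \<le> \<epsilon>"
  shows "FF (Lam :: real^'r^'n) \<alpha> P \<le> \<epsilon>"
  unfolding FF_eq_Sup_FF_term
proof (rule cSup_least)
  show "{FF_term P (Lam *v \<alpha>) q a | q a. 1 \<le> q} \<noteq> {}" by blast
qed (use assms in auto)

lemma FF_le_1:
  assumes "0 \<le> P"
  shows "FF (Lam :: real^'r^'n) \<alpha> P \<le> 1"
proof (rule FF_le)
  fix q :: nat and a assume "1 \<le> q"
  have "1 / 1 \<le> real q + P * \<bar>real q * (Lam *v \<alpha>) $ w - of_int (a $ w)\<bar>" for w
    using assms \<open>1 \<le> q\<close> by (simp add: add_increasing2)
  then show "FF_term P (Lam *v \<alpha>) q a \<le> 1"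
    by (rule FF_term_le_if_factor_large[OF assms \<open>1 \<le> q\<close> zero_less_one])
qed

lemma Rats_if_mult_Ints: "(n::nat) \<noteq> 0 \<Longrightarrow> real n * x \<in> \<int> \<Longrightarrow> x \<in> \<rat>"
  by (metis Ints_cases Rats_divide Rats_of_int Rats_of_nat nonzero_mult_div_cancel_left of_nat_eq_0_iff)

text \<open>Minimise the continuous positive function \<open>(y, q) \<mapsto> \<Sum>\<^sub>v infdist (q y\<^sub>v) \<int>\<close> over
  the compact set \<open>Y \<times> {1..<Q}\<close>.\<close>

lemma compact_irrational_uniformly_far_from_lattice:
  fixes Y :: "(real^'n) set"
  assumes "compact Y" and irr: "\<And>y. y \<in> Y \<Longrightarrow> \<exists>v. y $ v \<notin> \<rat>"
  shows "\<exists>c>0. \<forall>y\<in>Y. \<forall>q. 1 \<le> q \<and> q < Q \<longrightarrow> (\<forall>a::int^'n. \<exists>w. c \<le> \<bar>real q * y $ w - of_int (a $ w)\<bar>)"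
proof -
  define Z where "Z = Y \<times> (real ` {1..<Q})"
  define h where "h z = (\<Sum>v\<in>UNIV. infdist (snd z * fst z $ v) \<int>)" for z :: "(real^'n) \<times> real"
  have "compact Z" unfolding Z_def by (intro compact_Times \<open>compact Y\<close> finite_imp_compact) auto
  have "continuous_on Z h" unfolding h_def by (intro continuous_intros)
  have h_pos: "h z > 0" if "z \<in> Z" for z
  proof -
    obtain y q where z: "z = (y, real q)" "y \<in> Y" "q \<in> {1..<Q}" using \<open>z \<in> Z\<close> by (auto simp: Z_def)
    obtain v where "y $ v \<notin> \<rat>" using irr z(2) by blast
    then have "real q * y $ v \<notin> \<int>" using z(3) Rats_if_mult_Ints[of q] by auto
    then have "infdist (real q * y $ v) \<int> > 0"
      by (intro infdist_pos_not_in_closed) auto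
    then show ?thesis unfolding h_def z(1)
      by (intro sum_pos2[where i=v]) (auto simp: infdist_nonneg)
  qed
  obtain c where "c > 0" and c: "\<And>z. z \<in> Z \<Longrightarrow> c \<le> h z"
  proof (cases "Z = {}")
    case False
    then obtain z0 where "z0 \<in> Z" "\<And>z. z \<in> Z \<Longrightarrow> h z0 \<le> h z"
      using continuous_attains_inf[OF \<open>compact Z\<close> False \<open>continuous_on Z h\<close>] by blast
    then show ?thesis using that[of "h z0"] h_pos by blast
  qed (use that[of 1] in auto)
  define N where "N = real CARD('n)"
  have "N > 0" by (simp add: N_def)
  show ?thesis
  proof (intro exI[of _ "c / N"] conjI ballI allI impI)
    show "c / N > 0" using \<open>c > 0\<close> \<open>N > 0\<close> by simp
    fix y q and a :: "int^'n" assume "y \<in> Y" "1 \<le> q \<and> q < Q"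
    then have "c \<le> (\<Sum>v\<in>UNIV. infdist (real q * y $ v) \<int>)"
      using c[of "(y, real q)"] by (simp add: Z_def h_def)
    moreover have "(\<Sum>v\<in>UNIV. infdist (real q * y $ v) \<int>) < c"
      if "\<forall>w. infdist (real q * y $ w) \<int> < c / N"
    proof -
      have "(\<Sum>v\<in>UNIV. infdist (real q * y $ v) \<int>) < (\<Sum>v\<in>(UNIV::'n set). c / N)"
        using that by (intro sum_strict_mono) auto
      then show ?thesis using \<open>N > 0\<close> by (simp add: N_def)
    qed
    ultimately obtain w where w: "c / N \<le> infdist (real q * y $ w) \<int>"
      by (meson not_le)
    have "infdist (real q * y $ w) \<int> \<le> \<bar>real q * y $ w - of_int (a $ w)\<bar>"
      using infdist_le[of "of_int (a $ w)" \<int> "real q * y $ w"] by (simp add: dist_real_def)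
    with w show "\<exists>w. c / N \<le> \<bar>real q * y $ w - of_int (a $ w)\<bar>" by (meson order_trans)
  qed
qed

lemma small_vector_far_from_lattice:
  assumes "1 \<le> q" "2 * real q * supnorm y \<le> 1"
  shows "\<exists>w. supnorm y \<le> \<bar>real q * y $ w - of_int (a $ w)\<bar>"
proof -
  obtain w where w: "supnorm y = \<bar>y $ w\<bar>" using supnorm_attained by blast
  have qw: "\<bar>real q * y $ w\<bar> = real q * supnorm y" using w by (simp add: abs_mult)
  have "0 \<le> supnorm y" using supnorm_ge[of y w] by linarith
  then have "supnorm y \<le> real q * supnorm y"
    using assms(1) mult_right_mono[of 1 "real q" "supnorm y"] by simp
  moreover have "real q * supnorm y \<le> \<bar>real q * y $ w - of_int (a $ w)\<bar>"
  proof (cases "a $ w = 0")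
    case False
    then have "1 \<le> \<bar>of_int (a $ w) :: real\<bar>" by linarith
    then show ?thesis using qw assms(2) by linarith
  qed (use qw in simp)
  ultimately show ?thesis by (meson order_trans)
qed

lemma irrational_annulus_far_from_lattice:
  fixes S :: "(real^'n) set"
  assumes "closed S" and irr: "\<And>y. y \<in> S \<Longrightarrow> y \<noteq> 0 \<Longrightarrow> \<exists>v. y $ v \<notin> \<rat>" and "0 < \<eta>"
  shows "\<exists>c>0. \<forall>y\<in>S. \<eta> \<le> supnorm y \<and> supnorm y \<le> B \<longrightarrow>
           (\<forall>q. 1 \<le> q \<and> q < Q \<longrightarrow> (\<forall>a::int^'n. \<exists>w. c \<le> \<bar>real q * y $ w - of_int (a $ w)\<bar>))"
proof -
  define Y where "Y = (S \<inter> {y. \<eta> \<le> supnorm y}) \<inter> {y. supnorm y \<le> B}"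
  have "compact Y" unfolding Y_def
    by (intro compact_Int_supnorm_le closed_Int \<open>closed S\<close> closed_supnorm_ge)
  moreover have "\<exists>v. y $ v \<notin> \<rat>" if "y \<in> Y" for y
  proof -
    have "\<eta> \<le> supnorm y" using that by (simp add: Y_def)
    with \<open>0 < \<eta>\<close> have "0 < supnorm y" by linarith
    then have "y \<noteq> 0" using supnorm_attained[of y] by auto
    then show ?thesis using irr that by (auto simp: Y_def)
  qed
  ultimately obtain c where "0 < c" and
      "\<forall>y\<in>Y. \<forall>q. 1 \<le> q \<and> q < Q \<longrightarrow> (\<forall>a::int^'n. \<exists>w. c \<le> \<bar>real q * y $ w - of_int (a $ w)\<bar>)"
    using compact_irrational_uniformly_far_from_lattice[of Y Q] by blast
  then show ?thesis unfolding Y_def by blast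
qed

lemma FF_term_le_by_regimes:
  assumes "1 \<le> P" "1 \<le> q" "0 < \<epsilon>" "1 / \<epsilon> \<le> real Q"
    and small: "1 / \<epsilon> \<le> P * supnorm y"
    and annulus: "q < Q \<Longrightarrow> 1 / (2 * real Q) \<le> supnorm y \<Longrightarrow>
      \<exists>w. 1 / \<epsilon> \<le> P * \<bar>real q * y $ w - of_int (a $ w)\<bar>"
  shows "FF_term P y q a \<le> \<epsilon>"
proof -
  have "\<exists>w. 1 / \<epsilon> \<le> real q + P * \<bar>real q * y $ w - of_int (a $ w)\<bar>"
  proof (cases "Q \<le> q")
    case True
    then have "1 / \<epsilon> \<le> real q" using \<open>1 / \<epsilon> \<le> real Q\<close> by linarith
    then show ?thesis using \<open>1 \<le> P\<close> by (intro exI[of _ undefined]) (simp add: add_increasing2)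
  next
    case False
    have "\<exists>w. 1 / \<epsilon> \<le> P * \<bar>real q * y $ w - of_int (a $ w)\<bar>"
    proof (cases "supnorm y < 1 / (2 * real Q)")
      case True
      have "0 \<le> supnorm y" using supnorm_ge[of y] abs_ge_zero order_trans by blast
      then have "real q * supnorm y \<le> real Q * (1 / (2 * real Q))"
        using False True by (intro mult_mono) auto
      then have "2 * real q * supnorm y \<le> 1" using False by simp
      then obtain w where "supnorm y \<le> \<bar>real q * y $ w - of_int (a $ w)\<bar>"
        using small_vector_far_from_lattice \<open>1 \<le> q\<close> by blast
      then have "P * supnorm y \<le> P * \<bar>real q * y $ w - of_int (a $ w)\<bar>"
        using \<open>1 \<le> P\<close> by (intro mult_left_mono) auto
      then show ?thesis using small by (meson order_trans)
    qed (use annulus False in auto)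
    then show ?thesis by (meson add_increasing of_nat_0_le_iff order_trans)
  qed
  then obtain w where "1 / \<epsilon> \<le> real q + P * \<bar>real q * y $ w - of_int (a $ w)\<bar>" ..
  with assms(1-3) show ?thesis by (intro FF_term_le_if_factor_large) auto
qed

lemma FF_term_uniformly_small:
  fixes S :: "(real^'n) set"
  assumes "closed S" and irr: "\<And>y. y \<in> S \<Longrightarrow> y \<noteq> 0 \<Longrightarrow> \<exists>v. y $ v \<notin> \<rat>"
    and "0 < \<theta>" "0 < \<epsilon>"
  shows "\<exists>P0. \<forall>P\<ge>P0. \<forall>y\<in>S. P powr (\<theta> - 1) \<le> supnorm y \<and> supnorm y \<le> B \<longrightarrow>
           (\<forall>q\<ge>1. \<forall>a. FF_term P y q a \<le> \<epsilon>)"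
proof -
  obtain Q :: nat where "0 < Q" and Q: "inverse (real Q) < \<epsilon>"
    using ex_inverse_of_nat_less \<open>0 < \<epsilon>\<close> by blast
  have "1 / \<epsilon> \<le> real Q"
    using Q \<open>0 < Q\<close> \<open>0 < \<epsilon>\<close> by (simp add: field_simps)
  have "0 < 1 / (2 * real Q)" using \<open>0 < Q\<close> by simp
  then obtain c where "0 < c" and c: "\<And>y q a. y \<in> S \<Longrightarrow> 1 / (2 * real Q) \<le> supnorm y \<Longrightarrow>
      supnorm y \<le> B \<Longrightarrow> 1 \<le> q \<Longrightarrow> q < Q \<Longrightarrow> \<exists>w. c \<le> \<bar>real q * y $ w - of_int (a $ w)\<bar>"
    using irrational_annulus_far_from_lattice[OF \<open>closed S\<close> irr, of "1 / (2 * real Q)" B Q] by blast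
  define P0 where "P0 = max 1 (max ((1 / \<epsilon>) powr (1 / \<theta>)) (1 / (c * \<epsilon>)))"
  have "FF_term P y q a \<le> \<epsilon>"
    if "P0 \<le> P" "y \<in> S" and y: "P powr (\<theta> - 1) \<le> supnorm y" "supnorm y \<le> B" and "1 \<le> q" for P y q a
  proof (rule FF_term_le_by_regimes[OF _ \<open>1 \<le> q\<close> \<open>0 < \<epsilon>\<close> \<open>1 / \<epsilon> \<le> real Q\<close>])
    show "1 \<le> P" using that(1) by (simp add: P0_def)
    have "1 / \<epsilon> = ((1 / \<epsilon>) powr (1 / \<theta>)) powr \<theta>"
      using \<open>0 < \<theta>\<close> \<open>0 < \<epsilon>\<close> by (simp add: powr_powr)
    also have "\<dots> \<le> P powr \<theta>"
      using that(1) \<open>0 < \<theta>\<close> by (intro powr_mono2) (auto simp: P0_def)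
    also have "\<dots> = P * P powr (\<theta> - 1)"
      using \<open>1 \<le> P\<close> by (simp add: powr_diff field_simps)
    also have "\<dots> \<le> P * supnorm y"
      using y(1) \<open>1 \<le> P\<close> by (intro mult_left_mono) auto
    finally show "1 / \<epsilon> \<le> P * supnorm y" .
    assume "q < Q" "1 / (2 * real Q) \<le> supnorm y"
    then obtain w where w: "c \<le> \<bar>real q * y $ w - of_int (a $ w)\<bar>"
      using c \<open>y \<in> S\<close> y(2) \<open>1 \<le> q\<close> by blast
    have "1 / \<epsilon> = 1 / (c * \<epsilon>) * c" using \<open>0 < c\<close> by simp
    also have "\<dots> \<le> P * c" using that(1) \<open>0 < c\<close> by (intro mult_right_mono) (auto simp: P0_def)
    also have "\<dots> \<le> P * \<bar>real q * y $ w - of_int (a $ w)\<bar>"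
      using w \<open>1 \<le> P\<close> by (intro mult_left_mono) auto
    finally show "\<exists>w. 1 / \<epsilon> \<le> P * \<bar>real q * y $ w - of_int (a $ w)\<bar>" by blast
  qed
  then show ?thesis by blast
qed

lemma FF_eventually_small:
  fixes Lam :: "real ^ 'r ^ 'n"
  assumes irrat: "\<And>\<alpha>::real ^ 'r. \<alpha> \<noteq> 0 \<Longrightarrow> \<not> (\<forall>j. (Lam *v \<alpha>) $ j \<in> \<rat>)"
    and "0 < \<theta>" "0 < \<epsilon>"
  shows "\<forall>\<^sub>F P in at_top. \<forall>\<alpha>. P powr (\<theta> - 1) \<le> supnorm (Lam *v \<alpha>) \<and> supnorm (Lam *v \<alpha>) \<le> B
           \<longrightarrow> FF Lam \<alpha> P \<le> \<epsilon>"
proof -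
  have "closed (range ((*v) Lam))"
    by (intro closed_subspace subspace_UNIV linear_subspace_image matrix_vector_mul_linear)
  moreover have "\<exists>v. y $ v \<notin> \<rat>" if y: "y \<in> range ((*v) Lam)" "y \<noteq> 0" for y
  proof -
    obtain \<alpha> where "y = Lam *v \<alpha>" using y(1) by blast
    moreover from this have "\<alpha> \<noteq> 0" using y(2) by auto
    ultimately show ?thesis using irrat by blast
  qed
  ultimately obtain P0 where P0: "\<forall>P\<ge>P0. \<forall>y\<in>range ((*v) Lam). P powr (\<theta> - 1) \<le> supnorm y \<and>
      supnorm y \<le> B \<longrightarrow> (\<forall>q\<ge>1. \<forall>a. FF_term P y q a \<le> \<epsilon>)"
    using FF_term_uniformly_small[of "range ((*v) Lam)" \<theta> \<epsilon> B] assms(2,3) by blast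
  show ?thesis unfolding eventually_at_top_linorder
    by (intro exI[of _ P0] allI impI FF_le) (use P0 in blast)
qed

definition threshold_index :: "(nat \<Rightarrow> real) \<Rightarrow> real \<Rightarrow> nat" where
  "threshold_index thr P = Max {k. 1 \<le> k \<and> thr k \<le> P}"

context
  fixes thr :: "nat \<Rightarrow> real"
  assumes thr_ge: "\<And>k. real k \<le> thr k" and thr_1: "thr 1 \<le> 1"
begin

lemma finite_threshold_set: "finite {k. 1 \<le> k \<and> thr k \<le> P}"
proof (rule finite_subset)
  show "{k. 1 \<le> k \<and> thr k \<le> P} \<subseteq> {..nat \<lfloor>P\<rfloor>}"
    using thr_ge by (auto intro: le_nat_floor order_trans)
qed simp

lemma threshold_index_ge: "1 \<le> k \<Longrightarrow> thr k \<le> P \<Longrightarrow> k \<le> threshold_index thr P"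
  unfolding threshold_index_def by (rule Max_ge[OF finite_threshold_set]) simp

lemma threshold_index_mem:
  assumes "1 \<le> P"
  shows "1 \<le> threshold_index thr P \<and> thr (threshold_index thr P) \<le> P"
proof -
  have "1 \<in> {k. 1 \<le> k \<and> thr k \<le> P}" using assms thr_1 by simp
  then have "threshold_index thr P \<in> {k. 1 \<le> k \<and> thr k \<le> P}"
    unfolding threshold_index_def using finite_threshold_set by (intro Max_in) auto
  then show ?thesis by simp
qed

lemma threshold_index_mono: "1 \<le> P \<Longrightarrow> P \<le> P' \<Longrightarrow> threshold_index thr P \<le> threshold_index thr P'"
  using threshold_index_mem threshold_index_ge by (meson order_trans)

lemma filterlim_threshold_index: "filterlim (\<lambda>P. real (threshold_index thr P)) at_top at_top"
  unfolding filterlim_at_top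
proof
  fix Z :: real
  define k where "k = nat \<lceil>Z\<rceil> + 1"
  have "\<forall>\<^sub>F P in at_top. thr k \<le> P" by (rule eventually_ge_at_top)
  then show "\<forall>\<^sub>F P in at_top. Z \<le> real (threshold_index thr P)"
  proof (rule eventually_mono)
    fix P assume "thr k \<le> P"
    then have "k \<le> threshold_index thr P" by (intro threshold_index_ge) (simp add: k_def)
    then show "Z \<le> real (threshold_index thr P)" unfolding k_def by linarith
  qed
qed

end

lemma slowly_increasing_function_exists:
  assumes "0 < \<theta>" and eventually_G: "\<And>k::nat. 1 \<le> k \<Longrightarrow> eventually (G k) at_top"
  shows "\<exists>T. (\<forall>P\<ge>1. 1 \<le> T P) \<and> mono_on {1..} T \<and> filterlim T at_top at_top \<and>
             (\<forall>P\<ge>1. T P \<le> P powr \<theta>) \<and> (\<forall>P\<ge>1. \<exists>k. T P = real k \<and> (k = 1 \<or> G k P))"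
proof -
  have "\<forall>k. \<exists>P0. 1 \<le> k \<longrightarrow> (\<forall>P\<ge>P0. G k P)"
    using eventually_G by (auto simp: eventually_at_top_linorder)
  then obtain p where p: "\<And>k P. 1 \<le> k \<Longrightarrow> p k \<le> P \<Longrightarrow> G k P"
    by (metis choice)
  \<comment> \<open>\<open>real k \<le> thr k\<close> leaves finitely many candidates below \<open>P\<close>; \<open>k powr (1/\<theta>) \<le> thr k\<close> gives \<open>T P \<le> P powr \<theta>\<close>.\<close>
  define thr where "thr k = (if k \<le> 1 then 1 else max (p k) (max (real k) (real k powr (1 / \<theta>))))"
    for k :: nat
  have thr_ge: "real k \<le> thr k" for k by (auto simp: thr_def)
  have thr_1: "thr 1 \<le> 1" by (simp add: thr_def)
  note threshold = threshold_index_mem[OF thr_ge thr_1]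
  define T where "T P = real (threshold_index thr P)" for P
  have "T P \<le> P powr \<theta> \<and> (\<exists>k. T P = real k \<and> (k = 1 \<or> G k P))" if "1 \<le> P" for P
  proof -
    define k where "k = threshold_index thr P"
    have k: "1 \<le> k" "thr k \<le> P" using threshold[OF that] by (simp_all add: k_def)
    show ?thesis
    proof (cases "k = 1")
      case True
      have "1 \<le> P powr \<theta>" using that \<open>0 < \<theta>\<close> by (intro ge_one_powr_ge_zero) auto
      with True show ?thesis by (simp add: T_def k_def)
    next
      case False
      then have "p k \<le> P" "real k powr (1 / \<theta>) \<le> P" using k by (simp_all add: thr_def)
      then have "(real k powr (1 / \<theta>)) powr \<theta> \<le> P powr \<theta>" "G k P"
        using \<open>0 < \<theta>\<close> k(1) p by (auto intro: powr_mono2)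
      then show ?thesis using \<open>0 < \<theta>\<close> by (auto simp: powr_powr T_def k_def)
    qed
  qed
  moreover have "mono_on {1..} T"
    by (intro mono_onI) (simp add: T_def threshold_index_mono[OF thr_ge thr_1])
  moreover have "filterlim T at_top at_top"
    unfolding T_def by (rule filterlim_threshold_index[OF thr_ge thr_1])
  moreover have "1 \<le> T P" if "1 \<le> P" for P
    using threshold[OF that] by (simp add: T_def)
  ultimately show ?thesis by blast
qed

lemma FF_bound_on_slowly_growing_range:
  fixes Lam :: "real ^ 'r ^ 'n"
  assumes irrat: "\<And>\<alpha>::real ^ 'r. \<alpha> \<noteq> 0 \<Longrightarrow> \<not> (\<forall>j. (Lam *v \<alpha>) $ j \<in> \<rat>)" and "0 < \<theta>"
  shows "\<exists>T :: real \<Rightarrow> real.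
           (\<forall>P\<ge>1. T P \<ge> 1) \<and> mono_on {1..} T \<and> filterlim T at_top at_top \<and>
           (\<forall>P\<ge>1. T P \<le> P powr \<theta>) \<and>
           (\<forall>P\<ge>1. \<forall>\<alpha>::real ^ 'r.
              P powr (\<theta> - 1) \<le> supnorm (Lam *v \<alpha>) \<and> supnorm (Lam *v \<alpha>) \<le> T P
              \<longrightarrow> FF Lam \<alpha> P \<le> inverse (T P))"
proof -
  define G where "G k P \<longleftrightarrow> (\<forall>\<alpha>. P powr (\<theta> - 1) \<le> supnorm (Lam *v \<alpha>) \<and>
    supnorm (Lam *v \<alpha>) \<le> real k \<longrightarrow> FF Lam \<alpha> P \<le> inverse (real k))" for k P
  have eventually_G: "eventually (G k) at_top" if "1 \<le> k" for k :: nat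
    unfolding G_def using that by (intro FF_eventually_small[OF irrat \<open>0 < \<theta>\<close>]) auto
  obtain T where "\<forall>P\<ge>1. 1 \<le> T P" "mono_on {1..} T" "filterlim T at_top at_top"
    "\<forall>P\<ge>1. T P \<le> P powr \<theta>" and T_good: "\<forall>P\<ge>1. \<exists>k. T P = real k \<and> (k = 1 \<or> G k P)"
    using slowly_increasing_function_exists[where G = G, OF \<open>0 < \<theta>\<close> eventually_G] by blast
  moreover have "FF Lam \<alpha> P \<le> inverse (T P)" if "1 \<le> P"
    "P powr (\<theta> - 1) \<le> supnorm (Lam *v \<alpha>) \<and> supnorm (Lam *v \<alpha>) \<le> T P" for P \<alpha>
    using T_good FF_le_1[of P Lam \<alpha>] that unfolding G_def by fastforce
  ultimately show ?thesis by blast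
qed

theorem mainTheorem8:
  fixes Lam :: "real ^ 'r ^ 'n"
  assumes irrat: "\<And>\<alpha>::real ^ 'r. \<alpha> \<noteq> 0 \<Longrightarrow> \<not> (\<forall>j. (Lam *v \<alpha>) $ j \<in> \<rat>)"
  shows "\<exists>\<theta>0>0. \<forall>\<theta>. 0 < \<theta> \<and> \<theta> < \<theta>0 \<longrightarrow>
           (\<exists>T :: real \<Rightarrow> real.
              (\<forall>P\<ge>1. T P \<ge> 1) \<and> mono_on {1..} T \<and> filterlim T at_top at_top \<and>
              (\<forall>P\<ge>1. T P \<le> P powr \<theta>) \<and>
              (\<forall>P\<ge>1. \<forall>\<alpha>::real ^ 'r.
                  P powr (\<theta> - 1) \<le> supnorm (Lam *v \<alpha>) \<and> supnorm (Lam *v \<alpha>) \<le> T P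
                  \<longrightarrow> FF Lam \<alpha> P \<le> inverse (T P)))"
  using FF_bound_on_slowly_growing_range[OF irrat] by (intro exI[of _ "1::real"]) auto

end
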